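(* Let $(X,M,\ast)$ be a compact fuzzy metric space, where $\ast$ is the \L ukasiewicz t-norm, and let $\hat M$ be the fuzzy Prokhorov metric on the set $P(X)$ of Borel probability measures on $X$. Let a sequence $(\mu_i)_{i\in\mathbb N}$ in $P(X)$ converge to $\mu\in P(X)$ with respect to the topology induced by the fuzzy metric $\hat M$. Then $(\mu_i)$ weakly* converges to $\mu$.
   Context: The \L ukasiewicz t-norm is $x\ast y=\max\{x+y-1,0\}$ for $x,y\in[0,1]$. A fuzzy metric (in the sense of George and Veeramani) with respect to $\ast$ on a set $Z$ is a function $N\colon Z\times Z\times(0,\infty)\to[0,1]$ such that for all $x,y,z\in Z$ and $s,t>0$: (i) $N(x,y,t)>0$; (ii) $N(x,y,t)=1$ if and only if $x=y$; (iii) $N(x,y,t)=N(y,x,t)$; (iv) $N(x,y,t)\ast N(y,z,s)\le N(x,z,t+s)$; (v) $N(x,y,-)\colon(0,\infty)\to(0,1]$ is continuous. Then $(Z,N,\ast)$ is called a fuzzy metric space. The open balls $\{y\in Z\mid N(x,y,t)>1-r\}$, $x\in Z$, $r\in(0,1)$, $t>0$, form a base of a (metrizable) topology $\tau_N$ on $Z$, the topology induced by $N$. For the fuzzy metric space $(X,M,\ast)$ write $B(x,r,t)=\{y\in X\mid M(x,y,t)>1-r\}$; compactness, continuity and Borel sets in $X$ refer to $\tau_M$. For $A\subset X$, $A^{r,t}=\bigcup\{B(x,r,t)\mid x\in A\}$. The fuzzy Prokhorov metric $\hat M\colon P(X)\times P(X)\times(0,\infty)\to[0,1]$ is $$\hat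 M(\mu,\nu,t)=1-\inf\{r\in(0,1)\mid \mu(A)\le\nu(A^{r,t})+r \text{ and } \nu(A)\le\mu(A^{r,t})+r \text{ for every Borel } A\subset X\};$$ it is well defined and is a fuzzy metric on $P(X)$ with respect to $\ast$. $(\mu_i)$ weakly* converges to $\mu$ if $\lim_{i\to\infty}\int_X\varphi\,d\mu_i=\int_X\varphi\,d\mu$ for every continuous $\varphi\colon X\to\mathbb R$. *)

theory Defs
  imports "HOL-Probability.Probability"
begin

definition lukasiewicz :: "real \<Rightarrow> real \<Rightarrow> real" where
  "lukasiewicz x y = max (x + y - 1) 0"

text \<open>
  Fuzzy metrics in the sense of George and Veeramani with respect to the Lukasiewicz t-norm.
  A fuzzy metric is a function on \<open>Z \<times> Z \<times> (0,\<infinity>)\<close>; values of \<open>N\<close> outside this set are irrelevant.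
\<close>

definition fuzzy_metric_on :: "'a set \<Rightarrow> ('a \<Rightarrow> 'a \<Rightarrow> real \<Rightarrow> real) \<Rightarrow> bool" where
  "fuzzy_metric_on Z N \<longleftrightarrow>
     (\<forall>x\<in>Z. \<forall>y\<in>Z. \<forall>t>0. N x y t \<in> {0..1}) \<and>
     (\<forall>x\<in>Z. \<forall>y\<in>Z. \<forall>t>0. N x y t > 0) \<and>
     (\<forall>x\<in>Z. \<forall>y\<in>Z. \<forall>t>0. N x y t = 1 \<longleftrightarrow> x = y) \<and>
     (\<forall>x\<in>Z. \<forall>y\<in>Z. \<forall>t>0. N x y t = N y x t) \<and>
     (\<forall>x\<in>Z. \<forall>y\<in>Z. \<forall>z\<in>Z. \<forall>s>0. \<forall>t>0.
        lukasiewicz (N x y t) (N y z s) \<le> N x z (t + s)) \<and>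
     (\<forall>x\<in>Z. \<forall>y\<in>Z. continuous_on {0<..} (N x y))"

definition fuzzy_ball ::
  "'a set \<Rightarrow> ('a \<Rightarrow> 'a \<Rightarrow> real \<Rightarrow> real) \<Rightarrow> 'a \<Rightarrow> real \<Rightarrow> real \<Rightarrow> 'a set" where
  "fuzzy_ball Z N x r t = {y \<in> Z. N x y t > 1 - r}"

definition fuzzy_balls :: "'a set \<Rightarrow> ('a \<Rightarrow> 'a \<Rightarrow> real \<Rightarrow> real) \<Rightarrow> 'a set set" where
  "fuzzy_balls Z N = {fuzzy_ball Z N x r t | x r t. x \<in> Z \<and> r \<in> {0<..<1} \<and> t > 0}"

text \<open>
  The definition makes sense for every \<open>N\<close>. When \<open>N\<close> is a fuzzy metric, the open balls are not
  merely a subbase but a base; see \<open>openin_fuzzy_topology_base\<close> below.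
\<close>

definition fuzzy_topology :: "'a set \<Rightarrow> ('a \<Rightarrow> 'a \<Rightarrow> real \<Rightarrow> real) \<Rightarrow> 'a topology" where
  "fuzzy_topology Z N = topology_generated_by (fuzzy_balls Z N)"

lemma fuzzy_metric_onD:
  assumes "fuzzy_metric_on Z N" "x \<in> Z" "y \<in> Z"
  shows "t > 0 \<Longrightarrow> N x y t \<le> 1"
    and "z \<in> Z \<Longrightarrow> s > 0 \<Longrightarrow> t > 0 \<Longrightarrow> lukasiewicz (N x y t) (N y z s) \<le> N x z (t + s)"
    and "continuous_on {0<..} (N x y)"
  using assms by (simp_all add: fuzzy_metric_on_def)

lemma fuzzy_metric_mono:
  assumes N: "fuzzy_metric_on Z N" and "x \<in> Z" "y \<in> Z" and "0 < s" "s \<le> t"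
  shows "N x y s \<le> N x y t"
proof (cases "s = t")
  case False
  then have "0 < t - s" using assms by simp
  have "lukasiewicz (N x y s) (N y y (t - s)) \<le> N x y (s + (t - s))"
    using fuzzy_metric_onD(2)[OF N] assms \<open>0 < t - s\<close> by blast
  moreover have "N y y (t - s) = 1"
    using N \<open>y \<in> Z\<close> \<open>0 < t - s\<close> unfolding fuzzy_metric_on_def by blast
  ultimately show ?thesis by (simp add: lukasiewicz_def)
qed simp

lemma fuzzy_ball_center:
  assumes "fuzzy_metric_on Z N" "x \<in> Z" "0 < r" "0 < t"
  shows "x \<in> fuzzy_ball Z N x r t"
proof -
  have "N x x t = 1" using assms unfolding fuzzy_metric_on_def by blast
  then show ?thesis using assms by (simp add: fuzzy_ball_def)
qed

lemma fuzzy_ball_mono: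
  assumes "fuzzy_metric_on Z N" "x \<in> Z" "0 < s" "s \<le> t" "r \<le> q"
  shows "fuzzy_ball Z N x r s \<subseteq> fuzzy_ball Z N x q t"
proof
  fix y assume y: "y \<in> fuzzy_ball Z N x r s"
  then have "N x y s \<le> N x y t"
    using fuzzy_metric_mono[OF assms(1)] assms by (simp add: fuzzy_ball_def)
  with y \<open>r \<le> q\<close> show "y \<in> fuzzy_ball Z N x q t" by (simp add: fuzzy_ball_def)
qed

lemma fuzzy_ball_inside:
  assumes N: "fuzzy_metric_on Z N" and "x \<in> Z" "r \<in> {0<..<1}" "t > 0"
    and y: "y \<in> fuzzy_ball Z N x r t"
  obtains q s where "q \<in> {0<..<1}" "s > 0" "fuzzy_ball Z N y q s \<subseteq> fuzzy_ball Z N x r t"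
proof -
  have yZ: "y \<in> Z" and gt: "N x y t > 1 - r" using y by (auto simp: fuzzy_ball_def)
  have "continuous_on {0<..} (N x y)"
    using fuzzy_metric_onD(3)[OF N \<open>x \<in> Z\<close> yZ] .
  then have "isCont (N x y) t"
    using \<open>t > 0\<close> by (simp add: continuous_on_eq_continuous_at)
  then have "(N x y \<longlongrightarrow> N x y t) (nhds t)"
    unfolding isCont_def tendsto_at_iff_tendsto_nhds .
  then have "eventually (\<lambda>u. N x y u > 1 - r) (nhds t)"
    using gt by (rule order_tendstoD(1))
  then obtain d where d: "d > 0" "\<And>u. dist u t < d \<Longrightarrow> N x y u > 1 - r"
    by (auto simp: eventually_nhds_metric)
  define u where "u = max (t - d / 2) (t / 2)"
  have u: "0 < u" "u < t" using d \<open>t > 0\<close> by (auto simp: u_def)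
  have "dist u t < d" using d \<open>t > 0\<close> by (auto simp: u_def dist_real_def)
  then have gu: "N x y u > 1 - r" by (rule d)
  have "N x y u \<le> 1"
    using fuzzy_metric_onD(1)[OF N \<open>x \<in> Z\<close> yZ u(1)] .
  then have q: "N x y u - (1 - r) \<in> {0<..<1}"
    using gu \<open>r \<in> {0<..<1}\<close> by auto
  have sub: "fuzzy_ball Z N y (N x y u - (1 - r)) (t - u) \<subseteq> fuzzy_ball Z N x r t"
  proof
    fix z assume "z \<in> fuzzy_ball Z N y (N x y u - (1 - r)) (t - u)"
    then have z: "z \<in> Z" "N y z (t - u) > 1 - (N x y u - (1 - r))"
      by (auto simp: fuzzy_ball_def)
    have "0 < t - u" using u by simp
    then have "lukasiewicz (N x y u) (N y z (t - u)) \<le> N x z (u + (t - u))"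
      using fuzzy_metric_onD(2)[OF N \<open>x \<in> Z\<close> yZ z(1)] u(1) by blast
    with z show "z \<in> fuzzy_ball Z N x r t"
      by (auto simp: fuzzy_ball_def lukasiewicz_def)
  qed
  have "0 < t - u" using u by simp
  from that[OF q this sub] show ?thesis .
qed

lemma openin_fuzzy_topology_iff:
  assumes N: "fuzzy_metric_on Z N"
  shows "openin (fuzzy_topology Z N) U \<longleftrightarrow>
    U \<subseteq> Z \<and> (\<forall>x\<in>U. \<exists>r\<in>{0<..<1}. \<exists>t>0. fuzzy_ball Z N x r t \<subseteq> U)" (is "_ \<longleftrightarrow> ?R U")
proof
  assume "openin (fuzzy_topology Z N) U"
  then have "generate_topology_on (fuzzy_balls Z N) U"
    by (simp add: fuzzy_topology_def openin_topology_generated_by_iff)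
  then show "?R U"
  proof induction
    case Empty
    show ?case by simp
  next
    case (Int U V)
    show ?case
    proof (intro conjI ballI)
      show "U \<inter> V \<subseteq> Z" using Int by auto
      fix x assume x: "x \<in> U \<inter> V"
      then obtain r t q s where
        *: "r \<in> {0<..<1}" "t > 0" "fuzzy_ball Z N x r t \<subseteq> U"
           "q \<in> {0<..<1}" "s > 0" "fuzzy_ball Z N x q s \<subseteq> V"
        using Int by (metis IntE)
      have "x \<in> Z" using x Int by auto
      have "fuzzy_ball Z N x (min r q) (min t s) \<subseteq> fuzzy_ball Z N x r t"
           "fuzzy_ball Z N x (min r q) (min t s) \<subseteq> fuzzy_ball Z N x q s"
        using * by (intro fuzzy_ball_mono[OF N \<open>x \<in> Z\<close>]; simp)+
      then have "fuzzy_ball Z N x (min r q) (min t s) \<subseteq> U \<inter> V" using * by blast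
      moreover have "min r q \<in> {0<..<1}" "min t s > 0" using * by auto
      ultimately show "\<exists>r\<in>{0<..<1}. \<exists>t>0. fuzzy_ball Z N x r t \<subseteq> U \<inter> V" by blast
    qed
  next
    case (UN K)
    show ?case
    proof (intro conjI ballI)
      show "\<Union>K \<subseteq> Z" using UN.IH by blast
      fix x assume "x \<in> \<Union>K"
      then obtain k where k: "k \<in> K" "x \<in> k" by blast
      then obtain r t where "r \<in> {0<..<1}" "t > 0" "fuzzy_ball Z N x r t \<subseteq> k"
        using UN.IH by blast
      moreover have "k \<subseteq> \<Union>K" using k by blast
      ultimately show "\<exists>r\<in>{0<..<1}. \<exists>t>0. fuzzy_ball Z N x r t \<subseteq> \<Union>K" by blast
    qed
  next
    case (Basis B)
    then obtain x r t where B: "B = fuzzy_ball Z N x r t" "x \<in> Z" "r \<in> {0<..<1}" "t > 0"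
      by (auto simp: fuzzy_balls_def)
    show ?case
    proof (intro conjI ballI)
      show "B \<subseteq> Z" using B by (auto simp: fuzzy_ball_def)
      fix y assume "y \<in> B"
      then show "\<exists>r\<in>{0<..<1}. \<exists>t>0. fuzzy_ball Z N y r t \<subseteq> B"
        using fuzzy_ball_inside[OF N B(2-4)] B(1) by metis
    qed
  qed
next
  assume R: "?R U"
  have "U = \<Union>{B \<in> fuzzy_balls Z N. B \<subseteq> U}"
  proof
    show "U \<subseteq> \<Union>{B \<in> fuzzy_balls Z N. B \<subseteq> U}"
    proof
      fix x assume "x \<in> U"
      with R obtain r t where rt: "r \<in> {0<..<1}" "t > 0" "fuzzy_ball Z N x r t \<subseteq> U" "x \<in> Z"
        by blast
      then have "fuzzy_ball Z N x r t \<in> {B \<in> fuzzy_balls Z N. B \<subseteq> U}"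
        by (auto simp: fuzzy_balls_def)
      moreover have "x \<in> fuzzy_ball Z N x r t"
        using rt by (intro fuzzy_ball_center[OF N]) auto
      ultimately show "x \<in> \<Union>{B \<in> fuzzy_balls Z N. B \<subseteq> U}" by blast
    qed
  qed blast
  moreover have "openin (fuzzy_topology Z N) (\<Union>{B \<in> fuzzy_balls Z N. B \<subseteq> U})"
    by (rule openin_Union) (simp add: fuzzy_topology_def topology_generated_by_Basis)
  ultimately show "openin (fuzzy_topology Z N) U" by simp
qed

lemma openin_fuzzy_topology_base:
  assumes N: "fuzzy_metric_on Z N"
  shows "openin (fuzzy_topology Z N) = arbitrary union_of (\<lambda>B. B \<in> fuzzy_balls Z N)"
proof (rule ext, rule iffI)
  fix U assume U: "openin (fuzzy_topology Z N) U"
  have "\<exists>B. B \<in> fuzzy_balls Z N \<and> x \<in> B \<and> B \<subseteq> U" if "x \<in> U" for x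
  proof -
    from U that obtain r t where rt: "r \<in> {0<..<1}" "t > 0" "fuzzy_ball Z N x r t \<subseteq> U" "x \<in> Z"
      unfolding openin_fuzzy_topology_iff[OF N] by blast
    then have "fuzzy_ball Z N x r t \<in> fuzzy_balls Z N" by (auto simp: fuzzy_balls_def)
    moreover have "x \<in> fuzzy_ball Z N x r t"
      using rt by (intro fuzzy_ball_center[OF N]) auto
    ultimately show ?thesis using rt by blast
  qed
  then show "(arbitrary union_of (\<lambda>B. B \<in> fuzzy_balls Z N)) U"
    by (simp add: arbitrary_union_of_alt)
next
  fix U assume "(arbitrary union_of (\<lambda>B. B \<in> fuzzy_balls Z N)) U"
  then obtain \<U> where "\<U> \<subseteq> fuzzy_balls Z N" "U = \<Union>\<U>"
    by (auto simp: union_of_def arbitrary_def)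
  then show "openin (fuzzy_topology Z N) U"
    unfolding fuzzy_topology_def
    by (blast intro: openin_Union topology_generated_by_Basis)
qed

lemma topspace_fuzzy_topology:
  assumes N: "fuzzy_metric_on Z N"
  shows "topspace (fuzzy_topology Z N) = Z"
proof
  show "topspace (fuzzy_topology Z N) \<subseteq> Z"
    using openin_topspace[of "fuzzy_topology Z N"]
    unfolding openin_fuzzy_topology_iff[OF N] by (rule conjunct1)
  have "\<exists>r\<in>{0<..<1}. \<exists>t>0. fuzzy_ball Z N x r t \<subseteq> Z" if "x \<in> Z" for x
    by (intro bexI[of _ "1/2"] exI[of _ 1]) (auto simp: fuzzy_ball_def)
  then have "openin (fuzzy_topology Z N) Z"
    unfolding openin_fuzzy_topology_iff[OF N] by blast
  then show "Z \<subseteq> topspace (fuzzy_topology Z N)" by (rule openin_subset)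
qed

definition fuzzy_enlargement ::
  "'a set \<Rightarrow> ('a \<Rightarrow> 'a \<Rightarrow> real \<Rightarrow> real) \<Rightarrow> 'a set \<Rightarrow> real \<Rightarrow> real \<Rightarrow> 'a set" where
  "fuzzy_enlargement X M A r t = (\<Union>x\<in>A. fuzzy_ball X M x r t)"

definition borel_of :: "'a topology \<Rightarrow> 'a measure" where
  "borel_of T = sigma (topspace T) {U. openin T U}"

definition borel_prob_measures :: "'a topology \<Rightarrow> 'a measure set" where
  "borel_prob_measures T = {\<mu>. prob_space \<mu> \<and> sets \<mu> = sets (borel_of T)}"

text \<open>
  For a compact fuzzy metric space, Borel probability measures \<open>\<mu>\<close>, \<open>\<nu>\<close> and \<open>t > 0\<close>, the set under
  the infimum is nonempty: \<open>M\<close> is bounded away from \<open>0\<close> at \<open>t\<close>, so \<open>A\<close> has enlargement \<open>X\<close> for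
  every nonempty \<open>A\<close> once \<open>r\<close> is close enough to \<open>1\<close>. Hence the \<open>Inf\<close> on \<open>real\<close> is the usual one.
\<close>

definition fuzzy_prokhorov ::
  "'a set \<Rightarrow> ('a \<Rightarrow> 'a \<Rightarrow> real \<Rightarrow> real) \<Rightarrow> 'a measure \<Rightarrow> 'a measure \<Rightarrow> real \<Rightarrow> real" where
  "fuzzy_prokhorov X M \<mu> \<nu> t =
     1 - Inf {r \<in> {0<..<1}. \<forall>A \<in> sets (borel_of (fuzzy_topology X M)).
                measure \<mu> A \<le> measure \<nu> (fuzzy_enlargement X M A r t) + r \<and>
                measure \<nu> A \<le> measure \<mu> (fuzzy_enlargement X M A r t) + r}"

definition weak_star_converges ::
  "'a topology \<Rightarrow> (nat \<Rightarrow> 'a measure) \<Rightarrow> 'a measure \<Rightarrow> bool" where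
  "weak_star_converges T \<mu>s \<mu> \<longleftrightarrow>
     (\<forall>\<phi>. continuous_map T euclideanreal \<phi> \<longrightarrow>
        (\<lambda>i. integral\<^sup>L (\<mu>s i) \<phi>) \<longlonglongrightarrow> integral\<^sup>L \<mu> \<phi>)"

end

theory Submission
  imports Defs
begin

text \<open>
  On a compact space a continuous \<open>\<phi>\<close> is uniformly continuous, so for suitable \<open>t\<close> and all
  small \<open>r\<close> the enlargement of \<open>{\<phi> > s}\<close> lies in \<open>{\<phi> > s - e}\<close>. Hence if \<open>\<mu>\<close> and \<open>\<nu>\<close> are close
  in the Prokhorov sense, then \<open>\<mu> {\<phi> > s} \<le> \<nu> {\<phi> > s - e} + r\<close> for every \<open>s\<close>. Approximating the
  integral of a nonnegative function by the layer sum \<open>e * (\<Sum>k. \<mu> {\<phi> > (k + 1) e})\<close> with error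
  at most \<open>e\<close>, a shift of the level by \<open>e\<close> is a shift of the index by one and costs at most \<open>e\<close>.
\<close>

section \<open>Uniform constants on compact spaces\<close>

text \<open>Finitely many of the neighbourhoods \<open>U x\<close> cover the space, and by
  \<open>anti\<close> the smallest of their constants works on all of them. This serves both for a
  uniform lower bound and for uniform continuity.\<close>

lemma compact_space_uniform:
  fixes P :: "real \<Rightarrow> 'a \<Rightarrow> bool"
  assumes "compact_space T"
    and ev: "\<And>x. x \<in> topspace T \<Longrightarrow> \<exists>U e. openin T U \<and> x \<in> U \<and> 0 < e \<and> (\<forall>y\<in>U. P e y)"
    and anti: "\<And>d e y. 0 < d \<Longrightarrow> d \<le> e \<Longrightarrow> y \<in> topspace T \<Longrightarrow> P e y \<Longrightarrow> P d y"
  shows "\<exists>d>0. \<forall>y\<in>topspace T. P d y"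
proof -
  obtain U e where Ue: "\<And>x. x \<in> topspace T \<Longrightarrow>
      openin T (U x) \<and> x \<in> U x \<and> 0 < e x \<and> (\<forall>y\<in>U x. P (e x) y)"
    using ev by metis
  have "\<exists>\<F>. finite \<F> \<and> \<F> \<subseteq> U ` topspace T \<and> topspace T \<subseteq> \<Union>\<F>"
    using assms(1) Ue by (intro compactinD[of T "topspace T"]) (auto simp: compact_space_def)
  then obtain F where F: "finite F" "F \<subseteq> topspace T" "topspace T \<subseteq> \<Union>(U ` F)"
    by (metis finite_subset_image)
  \<comment> \<open>The inserted 1 keeps \<open>Min\<close> meaningful when \<open>F\<close> is
    empty, that is, over an empty space.\<close>
  define d where "d = Min (insert 1 (e ` F))"
  have "0 < d"
    using F Ue by (auto simp: d_def)
  moreover have "P d y" if y: "y \<in> topspace T" for y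
  proof -
    obtain x where x: "x \<in> F" "y \<in> U x" using F y by blast
    then have "d \<le> e x" using F by (auto simp: d_def)
    with x F Ue y \<open>0 < d\<close> show ?thesis by (intro anti[of d "e x" y]) auto
  qed
  ultimately show ?thesis by blast
qed

lemma openin_fuzzy_ball:
  assumes "x \<in> X" "r \<in> {0<..<1}" "0 < t"
  shows "openin (fuzzy_topology X M) (fuzzy_ball X M x r t)"
  unfolding fuzzy_topology_def fuzzy_balls_def
  by (rule topology_generated_by_Basis) (use assms in blast)

lemma fuzzy_metric_triangle:
  assumes "fuzzy_metric_on X M" "x \<in> X" "y \<in> X" "z \<in> X" "0 < s" "0 < t"
  shows "M x y t + M y z s - 1 \<le> M x z (t + s)"
  using fuzzy_metric_onD(2)[OF assms(1-6)] by (simp add: lukasiewicz_def)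

lemma fuzzy_metric_commute:
  assumes "fuzzy_metric_on X M" "x \<in> X" "y \<in> X" "0 < t"
  shows "M x y t = M y x t"
  using assms unfolding fuzzy_metric_on_def by blast

text \<open>Near a pair \<open>(a, b)\<close> the value at time \<open>t\<close> cannot drop far:
  continuity in time leaves a little of \<open>t\<close> to spare, and the triangle inequality
  spends it on the moves from \<open>x\<close> to \<open>a\<close> and from \<open>b\<close> to
  \<open>y\<close>. Compactness of the product then turns the local bounds into a global
  one.\<close>

lemma fuzzy_metric_bounded_below:
  assumes N: "fuzzy_metric_on X M" and C: "compact_space (fuzzy_topology X M)" and "0 < t"
  shows "\<exists>c>0. \<forall>x\<in>X. \<forall>y\<in>X. c \<le> M x y t"
proof -
  let ?T = "prod_topology (fuzzy_topology X M) (fuzzy_topology X M)"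
  have top: "topspace ?T = X \<times> X"
    by (simp add: topspace_fuzzy_topology[OF N])
  have "\<exists>c>0. \<forall>p\<in>topspace ?T. c \<le> M (fst p) (snd p) t"
  proof (rule compact_space_uniform)
    show "compact_space ?T"
      using C by (simp add: compact_space_prod_topology)
    fix p assume "p \<in> topspace ?T"
    then obtain a b where p: "p = (a, b)" "a \<in> X" "b \<in> X" using top by auto
    define m where "m = M a b t"
    have m: "0 < m" "m \<le> 1"
      using N p \<open>0 < t\<close> unfolding fuzzy_metric_on_def m_def by auto
    have "isCont (M a b) t"
      using fuzzy_metric_onD(3)[OF N p(2,3)] \<open>0 < t\<close>
      by (simp add: continuous_on_eq_continuous_at)
    then have "(M a b \<longlongrightarrow> m) (at t)" by (simp add: isCont_def m_def)
    then have "eventually (\<lambda>u. m / 2 < M a b u) (at t)"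
      using m by (intro order_tendstoD) auto
    then obtain d where d: "0 < d" "\<And>u. u \<noteq> t \<Longrightarrow> dist u t < d \<Longrightarrow> m / 2 < M a b u"
      unfolding eventually_at by blast
    \<comment> \<open>Each of the two moves takes time \<open>s\<close>. The remaining time
      \<open>t - 2 * s\<close> must stay positive and within \<open>d\<close> of
      \<open>t\<close>.\<close>
    define s where "s = min (d / 4) (t / 4)"
    have s: "0 < s" "0 < t - 2 * s" using d \<open>0 < t\<close> by (auto simp: s_def)
    have ms: "m / 2 < M a b (t - 2 * s)"
      using d \<open>0 < t\<close> by (intro d(2)) (auto simp: s_def dist_real_def)
    \<comment> \<open>Each move costs less than \<open>m / 8\<close>, so more than
      \<open>m / 2 - 2 * (m / 8) = m / 4\<close> survives.\<close>
    let ?U = "fuzzy_ball X M a (m / 8) s" and ?V = "fuzzy_ball X M b (m / 8) s"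
    have "openin ?T (?U \<times> ?V)"
      using m s p by (auto simp: openin_prod_Times_iff intro!: openin_fuzzy_ball)
    moreover have "p \<in> ?U \<times> ?V"
      using m s p by (auto intro!: fuzzy_ball_center[OF N])
    moreover have "m / 4 \<le> M (fst q) (snd q) t" if "q \<in> ?U \<times> ?V" for q
    proof -
      obtain x y where q: "q = (x, y)" "x \<in> X" "y \<in> X"
        "1 - m / 8 < M a x s" "1 - m / 8 < M b y s"
        using \<open>q \<in> ?U \<times> ?V\<close> by (auto simp: fuzzy_ball_def)
      have "M x a s + M a b (t - 2 * s) - 1 \<le> M x b (s + (t - 2 * s))"
        using q p s by (intro fuzzy_metric_triangle[OF N]) auto
      moreover have "M x b (t - s) + M b y s - 1 \<le> M x y (t - s + s)"
        using q p s by (intro fuzzy_metric_triangle[OF N]) auto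
      moreover have "M x a s = M a x s"
        using fuzzy_metric_commute[OF N] q p s by blast
      ultimately show ?thesis using q ms by simp
    qed
    ultimately show "\<exists>U c. openin ?T U \<and> p \<in> U \<and> 0 < c \<and> (\<forall>q\<in>U. c \<le> M (fst q) (snd q) t)"
      using m by (intro exI[of _ "?U \<times> ?V"] exI[of _ "m / 4"]) auto
  qed auto
  then show ?thesis unfolding top by auto
qed

text \<open>This is the Lebesgue number argument. One \<open>d\<close> plays both radius and time;
  since \<open>M\<close> grows with time, the premise \<open>1 - d < M x y d\<close> becomes
  stronger as \<open>d\<close> shrinks, which is the monotonicity that
  \<open>compact_space_uniform\<close> asks for.\<close>

lemma fuzzy_uniformly_continuous:
  assumes N: "fuzzy_metric_on X M" and C: "compact_space (fuzzy_topology X M)"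
    and \<phi>: "continuous_map (fuzzy_topology X M) euclideanreal \<phi>" and "0 < e"
  shows "\<exists>d>0. \<forall>x\<in>X. \<forall>y\<in>X. 1 - d < M x y d \<longrightarrow> \<bar>\<phi> x - \<phi> y\<bar> < e"
proof -
  let ?T = "fuzzy_topology X M"
  have top: "topspace ?T = X" by (rule topspace_fuzzy_topology[OF N])
  have "\<exists>d>0. \<forall>x\<in>topspace ?T. \<forall>y\<in>X. 1 - d < M x y d \<longrightarrow> \<bar>\<phi> x - \<phi> y\<bar> < e"
  proof (rule compact_space_uniform[OF C])
    fix a assume "a \<in> topspace ?T"
    then have a: "a \<in> X" by (simp add: top)
    have "openin ?T {x \<in> topspace ?T. \<phi> x \<in> ball (\<phi> a) (e / 2)}"
      by (rule openin_continuous_map_preimage[OF \<phi>]) (simp flip: open_openin)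
    then have "\<exists>r\<in>{0<..<1}. \<exists>t>0. fuzzy_ball X M a r t \<subseteq>
        {x \<in> topspace ?T. \<phi> x \<in> ball (\<phi> a) (e / 2)}"
      using a \<open>0 < e\<close> unfolding openin_fuzzy_topology_iff[OF N] by (auto simp: top)
    then obtain r t where rt: "0 < r" "r < 1" "0 < t"
      "\<And>x. x \<in> fuzzy_ball X M a r t \<Longrightarrow> dist (\<phi> a) (\<phi> x) < e / 2"
      by (auto simp: subset_iff)
    \<comment> \<open>Half of the radius and half of the time bring \<open>a\<close> to
      \<open>x\<close>, the other halves bring \<open>x\<close> to \<open>y\<close>. Both points
      then lie in the full ball about \<open>a\<close>, where \<phi> differs from
      \<open>\<phi> a\<close> by less than \<open>e / 2\<close>.\<close>
    define d where "d = min (r / 2) (t / 2)"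
    have d: "0 < d" "d \<le> r / 2" "d \<le> t / 2" using rt by (auto simp: d_def)
    let ?U = "fuzzy_ball X M a (r / 2) (t / 2)"
    have "\<bar>\<phi> x - \<phi> y\<bar> < e" if x: "x \<in> ?U" and y: "y \<in> X" "1 - d < M x y d" for x y
    proof -
      have x': "x \<in> X" "1 - r / 2 < M a x (t / 2)" using x by (auto simp: fuzzy_ball_def)
      have "M a x (t / 2) + M x y (t / 2) - 1 \<le> M a y (t / 2 + t / 2)"
        using a x' y rt by (intro fuzzy_metric_triangle[OF N]) auto
      moreover have "M x y d \<le> M x y (t / 2)"
        using x' y d by (intro fuzzy_metric_mono[OF N]) auto
      ultimately have "y \<in> fuzzy_ball X M a r t"
        using x' y d by (auto simp: fuzzy_ball_def)
      moreover have "x \<in> fuzzy_ball X M a r t"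
        using fuzzy_ball_mono[OF N a, of "t / 2" t "r / 2" r] rt x by auto
      ultimately show ?thesis
        using rt(4)[of x] rt(4)[of y] unfolding dist_real_def by argo
    qed
    moreover have "openin ?T ?U" "a \<in> ?U"
      using rt a by (auto intro!: openin_fuzzy_ball fuzzy_ball_center[OF N])
    ultimately show "\<exists>U d. openin ?T U \<and> a \<in> U \<and> 0 < d \<and>
        (\<forall>x\<in>U. \<forall>y\<in>X. 1 - d < M x y d \<longrightarrow> \<bar>\<phi> x - \<phi> y\<bar> < e)"
      using d(1) by blast
  next
    fix d c x
    assume "0 < d" "d \<le> c" "x \<in> topspace ?T"
      and "\<forall>y\<in>X. 1 - c < M x y c \<longrightarrow> \<bar>\<phi> x - \<phi> y\<bar> < e"
    moreover have "M x y d \<le> M x y c" if "y \<in> X" for y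
      using that calculation by (intro fuzzy_metric_mono[OF N]) (auto simp: top)
    ultimately show "\<forall>y\<in>X. 1 - d < M x y d \<longrightarrow> \<bar>\<phi> x - \<phi> y\<bar> < e"
      by fastforce
  qed
  then show ?thesis by (simp add: top)
qed

section \<open>Boundedness and Borel measurability of continuous functions\<close>

lemma compact_space_continuous_bounded:
  assumes "compact_space T" "continuous_map T euclideanreal \<phi>"
  obtains B where "0 < B" "\<And>x. x \<in> topspace T \<Longrightarrow> \<bar>\<phi> x\<bar> \<le> B"
proof -
  have "compactin euclideanreal (\<phi> ` topspace T)"
    using assms by (intro image_compactin) (auto simp: compact_space_def)
  then have "bounded (\<phi> ` topspace T)" by (simp add: compact_imp_bounded)
  with that show ?thesis by (auto simp: bounded_pos)
qed

lemma sets_borel_of: "openin T U \<Longrightarrow> U \<in> sets (borel_of T)"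
  unfolding borel_of_def
  by (subst sets_measure_of) (auto dest: openin_subset intro: sigma_sets.Basic)

lemma space_borel_of: "space (borel_of T) = topspace T"
  unfolding borel_of_def by (rule space_measure_of) (auto dest: openin_subset)

lemma borel_prob_measuresD:
  assumes "\<mu> \<in> borel_prob_measures T"
  shows "prob_space \<mu>" "sets \<mu> = sets (borel_of T)" "space \<mu> = topspace T"
proof -
  show "prob_space \<mu>" and s: "sets \<mu> = sets (borel_of T)"
    using assms by (auto simp: borel_prob_measures_def)
  show "space \<mu> = topspace T"
    using sets_eq_imp_space_eq[OF s] by (simp add: space_borel_of)
qed

lemma openin_superlevel:
  assumes "continuous_map T euclideanreal \<phi>"
  shows "openin T {x \<in> topspace T. s < \<phi> x}"
  using openin_continuous_map_preimage[OF assms, of "{s<..}"] by simp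

lemma borel_measurable_continuous_map:
  assumes "\<mu> \<in> borel_prob_measures T" "continuous_map T euclideanreal \<phi>"
  shows "\<phi> \<in> borel_measurable \<mu>"
  unfolding borel_measurable_iff_greater
  using openin_superlevel[OF assms(2)] borel_prob_measuresD[OF assms(1)]
  by (auto intro: sets_borel_of)

section \<open>Comparison of integrals through superlevel sets\<close>

text \<open>The sum is \<open>e\<close> times the number of levels
  \<open>e, 2 * e, ..., n * e\<close> strictly below \<open>y\<close>, a discretisation of
  \<open>y\<close> from below that is capped at \<open>n * e\<close>.\<close>

lemma layer_sum_bounds:
  fixes e y :: real
  assumes "0 < e" "0 \<le> y"
  shows "(\<Sum>k<n. e * of_bool (real (Suc k) * e < y)) \<le> y"
    and "min (y - e) (real n * e) \<le> (\<Sum>k<n. e * of_bool (real (Suc k) * e < y))"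
proof -
  \<comment> \<open>The cap \<open>real n * e\<close> in the upper bound strengthens the induction
    hypothesis: when a new level lies below \<open>y\<close>, it guarantees that adding
    \<open>e\<close> does not overshoot \<open>y\<close>.\<close>
  have "(\<Sum>k<n. e * of_bool (real (Suc k) * e < y)) \<le> min y (real n * e)
    \<and> min (y - e) (real n * e) \<le> (\<Sum>k<n. e * of_bool (real (Suc k) * e < y))"
    using assms by (induction n) (auto simp: min_def algebra_simps split: if_splits)
  then show "(\<Sum>k<n. e * of_bool (real (Suc k) * e < y)) \<le> y"
    and "min (y - e) (real n * e) \<le> (\<Sum>k<n. e * of_bool (real (Suc k) * e < y))"
    by auto
qed

text \<open>Both bounds come from integrating the pointwise bounds of
  \<open>layer_sum_bounds\<close>; the total mass 1 turns the pointwise error \<open>e\<close> into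
  an integral error \<open>e\<close>.\<close>

lemma integral_layer_sum:
  fixes e :: real
  assumes "prob_space \<mu>" and f: "f \<in> borel_measurable \<mu>" and "0 < e"
    and bd: "\<And>x. x \<in> space \<mu> \<Longrightarrow> 0 \<le> f x \<and> f x \<le> real n * e"
  shows "(\<Sum>k<n. e * measure \<mu> {x \<in> space \<mu>. real (Suc k) * e < f x}) \<le> integral\<^sup>L \<mu> f"
    and "integral\<^sup>L \<mu> f \<le> e + (\<Sum>k<n. e * measure \<mu> {x \<in> space \<mu>. real (Suc k) * e < f x})"
proof -
  interpret prob_space \<mu> by fact
  let ?A = "\<lambda>k. {x \<in> space \<mu>. real (Suc k) * e < f x}"
  let ?g = "\<lambda>x. \<Sum>k<n. e * indicat_real (?A k) x"
  have A: "?A k \<in> sets \<mu>" for k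
    using f by measurable
  have ind: "integrable \<mu> (\<lambda>x. e * indicat_real (?A k) x)" for k
    using A by (intro integrable_mult_right) (simp add: emeasure_eq_measure)
  have g: "integrable \<mu> ?g"
    using ind by (intro Bochner_Integration.integrable_sum)
  have int_g: "integral\<^sup>L \<mu> ?g = (\<Sum>k<n. e * measure \<mu> (?A k))"
    using A by (subst Bochner_Integration.integral_sum[OF ind]) simp
  have int_f: "integrable \<mu> f"
    using bd f by (intro integrable_const_bound[where B = "real n * e"]) auto
  have eq: "?g x = (\<Sum>k<n. e * of_bool (real (Suc k) * e < f x))" if "x \<in> space \<mu>" for x
    using that by (intro sum.cong) (auto simp: indicator_def)
  have "integral\<^sup>L \<mu> ?g \<le> integral\<^sup>L \<mu> f"
  proof (rule integral_mono[OF g int_f])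
    fix x assume x: "x \<in> space \<mu>"
    with bd layer_sum_bounds(1)[OF \<open>0 < e\<close>, of "f x" n] show "?g x \<le> f x"
      unfolding eq[OF x] by blast
  qed
  then show "(\<Sum>k<n. e * measure \<mu> (?A k)) \<le> integral\<^sup>L \<mu> f"
    by (simp only: int_g)
  have "integral\<^sup>L \<mu> f \<le> integral\<^sup>L \<mu> (\<lambda>x. e + ?g x)"
  proof (rule integral_mono[OF int_f])
    show "integrable \<mu> (\<lambda>x. e + ?g x)" using g by simp
    fix x assume x: "x \<in> space \<mu>"
    then have "0 \<le> f x" "f x \<le> real n * e" using bd by auto
    \<comment> \<open>Here the \<open>n\<close> layers must reach the top of the range of
      \<open>f\<close>, so that the cap has no effect.\<close>
    then have "f x - e \<le> min (f x - e) (real n * e)" using \<open>0 < e\<close> by simp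
    also have "\<dots> \<le> ?g x"
      unfolding eq[OF x] using layer_sum_bounds(2)[OF \<open>0 < e\<close> \<open>0 \<le> f x\<close>] .
    finally show "f x \<le> e + ?g x" by simp
  qed
  also have "\<dots> = e + integral\<^sup>L \<mu> ?g"
    using g by (subst Bochner_Integration.integral_add) (auto simp: prob_space)
  finally show "integral\<^sup>L \<mu> f \<le> e + (\<Sum>k<n. e * measure \<mu> (?A k))"
    by (simp only: int_g)
qed

text \<open>The error has three sources: one \<open>e\<close> from the layer sum for \<mu>, one
  \<open>e\<close> from the bottom level that the index shift brings in, and \<open>e * r\<close>
  from each of the \<open>n\<close> levels. The layer sum for \<nu> is a lower bound of its integral
  and adds no error.\<close>

lemma integral_le_of_superlevel_le:
  fixes e :: real
  assumes \<mu>: "prob_space \<mu>" "f \<in> borel_measurable \<mu>"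
    and \<nu>: "prob_space \<nu>" "f \<in> borel_measurable \<nu>" and sp: "space \<mu> = S" "space \<nu> = S"
    and "0 < e" and bd: "\<And>x. x \<in> S \<Longrightarrow> 0 \<le> f x \<and> f x \<le> real n * e"
    and le: "\<And>s. measure \<mu> {x \<in> S. s < f x} \<le> measure \<nu> {x \<in> S. s - e < f x} + r"
  shows "integral\<^sup>L \<mu> f \<le> integral\<^sup>L \<nu> f + 2 * e + real n * e * r"
proof -
  interpret \<nu>: prob_space \<nu> by fact
  let ?b = "\<lambda>k. measure \<nu> {x \<in> S. real k * e < f x}"
  have "integral\<^sup>L \<mu> f \<le> e + (\<Sum>k<n. e * measure \<mu> {x \<in> S. real (Suc k) * e < f x})"
    using integral_layer_sum(2)[OF \<mu> \<open>0 < e\<close>, of n] bd sp by simp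
  also have "(\<Sum>k<n. e * measure \<mu> {x \<in> S. real (Suc k) * e < f x}) \<le> (\<Sum>k<n. e * (?b k + r))"
  proof (intro sum_mono mult_left_mono)
    fix k
    have "real (Suc k) * e - e = real k * e" by (simp add: algebra_simps)
    with le[of "real (Suc k) * e"]
    show "measure \<mu> {x \<in> S. real (Suc k) * e < f x} \<le> ?b k + r" by simp
  qed (use \<open>0 < e\<close> in simp)
  also have "(\<Sum>k<n. e * (?b k + r)) = e * (\<Sum>k<n. ?b k) + real n * e * r"
    by (simp add: sum.distrib distrib_left sum_distrib_left)
  \<comment> \<open>Lowering all levels by \<open>e\<close> adds level 0, whose superlevel set has
    measure at most 1.\<close>
  also have "(\<Sum>k<n. ?b k) \<le> 1 + (\<Sum>k<n. ?b (Suc k))"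
  proof -
    have "(\<Sum>k<n. ?b k) \<le> (\<Sum>k<Suc n. ?b k)" by (simp add: sum_nonneg)
    also have "\<dots> = ?b 0 + (\<Sum>k<n. ?b (Suc k))" by (rule sum.lessThan_Suc_shift)
    finally show ?thesis using \<nu>.prob_le_1[of "{x \<in> S. real 0 * e < f x}"] by linarith
  qed
  also have "e * (1 + (\<Sum>k<n. ?b (Suc k))) = e + (\<Sum>k<n. e * ?b (Suc k))"
    by (simp add: distrib_left sum_distrib_left)
  also have "(\<Sum>k<n. e * ?b (Suc k)) \<le> integral\<^sup>L \<nu> f"
    using integral_layer_sum(1)[OF \<nu> \<open>0 < e\<close>, of n] bd sp by simp
  finally show ?thesis using \<open>0 < e\<close> by simp
qed

section \<open>From convergence in the fuzzy Prokhorov metric to inequalities between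
  measures\<close>

text \<open>This is the condition under the infimum in \<open>fuzzy_prokhorov\<close>.\<close>

definition prokhorov_close ::
  "'a set \<Rightarrow> ('a \<Rightarrow> 'a \<Rightarrow> real \<Rightarrow> real) \<Rightarrow> 'a measure \<Rightarrow> 'a measure \<Rightarrow> real \<Rightarrow> real \<Rightarrow> bool" where
  "prokhorov_close X M \<mu> \<nu> t r \<longleftrightarrow> (\<forall>A \<in> sets (borel_of (fuzzy_topology X M)).
      measure \<mu> A \<le> measure \<nu> (fuzzy_enlargement X M A r t) + r \<and>
      measure \<nu> A \<le> measure \<mu> (fuzzy_enlargement X M A r t) + r)"

lemma fuzzy_prokhorov_eq:
  "fuzzy_prokhorov X M \<mu> \<nu> t = 1 - Inf {r \<in> {0<..<1}. prokhorov_close X M \<mu> \<nu> t r}"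
  by (simp add: fuzzy_prokhorov_def prokhorov_close_def)

lemma sets_borel_subset:
  assumes "fuzzy_metric_on X M" "A \<in> sets (borel_of (fuzzy_topology X M))"
  shows "A \<subseteq> X"
  using sets.sets_into_space[OF assms(2)]
  by (simp add: space_borel_of topspace_fuzzy_topology[OF assms(1)])

text \<open>Every enlargement with positive parameters contains the set itself. The lemma serves to
  place \<mu> in the balls centred at \<mu>.\<close>

lemma prokhorov_close_self:
  assumes N: "fuzzy_metric_on X M" and \<mu>: "\<mu> \<in> borel_prob_measures (fuzzy_topology X M)"
    and "r \<in> {0<..<1}" "0 < t"
  shows "prokhorov_close X M \<mu> \<mu> t r"
proof -
  interpret prob_space \<mu> using borel_prob_measuresD[OF \<mu>] by simp
  have "measure \<mu> A \<le> measure \<mu> (fuzzy_enlargement X M A r t) + r"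
    if A: "A \<in> sets (borel_of (fuzzy_topology X M))" for A
  proof -
    have AX: "A \<subseteq> X" by (rule sets_borel_subset[OF N A])
    \<comment> \<open>A union of open balls is Borel. This matters because \<open>measure\<close> is
      0 on nonmeasurable sets, where monotonicity could fail.\<close>
    then have "openin (fuzzy_topology X M) (fuzzy_enlargement X M A r t)"
      unfolding fuzzy_enlargement_def using assms
      by (intro openin_Union) (auto intro!: openin_fuzzy_ball)
    then have "fuzzy_enlargement X M A r t \<in> sets \<mu>"
      using borel_prob_measuresD[OF \<mu>] by (simp add: sets_borel_of)
    moreover have "A \<subseteq> fuzzy_enlargement X M A r t"
      unfolding fuzzy_enlargement_def
      using AX assms by (fastforce intro: fuzzy_ball_center[OF N])
    ultimately have "measure \<mu> A \<le> measure \<mu> (fuzzy_enlargement X M A r t)"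
      by (intro finite_measure_mono)
    then show ?thesis using \<open>r \<in> {0<..<1}\<close> by simp
  qed
  then show ?thesis by (simp add: prokhorov_close_def)
qed

text \<open>For \<open>r\<close> close enough to 1 a single ball is all of \<open>X\<close>. Hence
  the infimum in \<open>fuzzy_prokhorov\<close> runs over a nonempty set.\<close>

lemma ex_prokhorov_close:
  assumes N: "fuzzy_metric_on X M" and C: "compact_space (fuzzy_topology X M)"
    and \<mu>: "\<mu> \<in> borel_prob_measures (fuzzy_topology X M)"
    and \<nu>: "\<nu> \<in> borel_prob_measures (fuzzy_topology X M)" and "0 < t"
  shows "\<exists>r\<in>{0<..<1}. prokhorov_close X M \<mu> \<nu> t r"
proof -
  interpret \<mu>: prob_space \<mu> using borel_prob_measuresD[OF \<mu>] by simp
  interpret \<nu>: prob_space \<nu> using borel_prob_measuresD[OF \<nu>] by simp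
  have sp: "space \<mu> = X" "space \<nu> = X"
    using borel_prob_measuresD[OF \<mu>] borel_prob_measuresD[OF \<nu>] topspace_fuzzy_topology[OF N]
    by auto
  obtain c where c: "0 < c" "\<And>x y. x \<in> X \<Longrightarrow> y \<in> X \<Longrightarrow> c \<le> M x y t"
    using fuzzy_metric_bounded_below[OF N C \<open>0 < t\<close>] by blast
  \<comment> \<open>The cap at 1 keeps \<open>r\<close> positive, and halving makes
    \<open>1 - r < c\<close> strict.\<close>
  define r where "r = 1 - min c 1 / 2"
  have r: "r \<in> {0<..<1}" "1 - r < c" using c(1) by (auto simp: r_def min_def)
  have "measure \<mu> A \<le> measure \<nu> (fuzzy_enlargement X M A r t) + r \<and>
      measure \<nu> A \<le> measure \<mu> (fuzzy_enlargement X M A r t) + r"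
    if A: "A \<in> sets (borel_of (fuzzy_topology X M))" for A
  proof (cases "A = {}")
    case True
    then show ?thesis using r by (simp add: fuzzy_enlargement_def)
  next
    case False
    then obtain a where a: "a \<in> A" by blast
    have "1 - r < M a y t" if "y \<in> X" for y
      using c(2)[of a y] that a sets_borel_subset[OF N A] r(2) by auto
    with a have "fuzzy_enlargement X M A r t = X"
      by (auto simp: fuzzy_enlargement_def fuzzy_ball_def)
    moreover have "measure \<mu> X = 1" "measure \<nu> X = 1"
      using \<mu>.prob_space \<nu>.prob_space sp by auto
    ultimately show ?thesis
      using r(1) \<mu>.prob_le_1[of A] \<nu>.prob_le_1[of A]
      by (simp only: greaterThanLessThan_iff) linarith
  qed
  with r show ?thesis unfolding prokhorov_close_def by blast
qed

text \<open>The ball about \<mu> is a generator of the topology and contains \<mu>, so it contains a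
  tail of the sequence. Membership says that an infimum lies below \<open>r\<close>, hence so does
  some admissible \<open>q\<close>, which may depend on \<open>i\<close>.\<close>

lemma limitin_fuzzy_prokhorov_close:
  assumes N: "fuzzy_metric_on X M" and C: "compact_space (fuzzy_topology X M)"
    and \<mu>s: "\<And>i. \<mu>s i \<in> borel_prob_measures (fuzzy_topology X M)"
    and \<mu>: "\<mu> \<in> borel_prob_measures (fuzzy_topology X M)"
    and lim: "limitin (fuzzy_topology (borel_prob_measures (fuzzy_topology X M))
           (fuzzy_prokhorov X M)) \<mu>s \<mu> sequentially"
    and r: "r \<in> {0<..<1}" and t: "0 < t"
  shows "eventually (\<lambda>i. \<exists>q\<in>{0<..<r}. prokhorov_close X M \<mu> (\<mu>s i) t q) sequentially"
proof -
  let ?P = "borel_prob_measures (fuzzy_topology X M)"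
  let ?S = "\<lambda>\<nu>. {q \<in> {0<..<1}. prokhorov_close X M \<mu> \<nu> t q}"
  let ?B = "fuzzy_ball ?P (fuzzy_prokhorov X M) \<mu> r t"
  have bdd: "bdd_below (?S \<nu>)" for \<nu>
    by (rule bdd_belowI[of _ 0]) auto
  have "openin (fuzzy_topology ?P (fuzzy_prokhorov X M)) ?B"
    by (rule openin_fuzzy_ball[OF \<mu> r t])
  moreover have "\<mu> \<in> ?B"
  proof -
    have "r / 2 \<in> ?S \<mu>"
      using r t by (auto intro!: prokhorov_close_self[OF N \<mu>])
    then have "Inf (?S \<mu>) \<le> r / 2" by (intro cInf_lower bdd)
    then show ?thesis using r \<mu> by (auto simp: fuzzy_ball_def fuzzy_prokhorov_eq)
  qed
  ultimately have "eventually (\<lambda>i. \<mu>s i \<in> ?B) sequentially"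
    using lim by (simp add: limitin_def)
  then show ?thesis
  proof (rule eventually_mono)
    fix i assume "\<mu>s i \<in> ?B"
    then have less: "Inf (?S (\<mu>s i)) < r" by (simp add: fuzzy_ball_def fuzzy_prokhorov_eq)
    have "?S (\<mu>s i) \<noteq> {}" using ex_prokhorov_close[OF N C \<mu> \<mu>s t] by blast
    from cInf_lessD[OF this less] obtain q where "q \<in> ?S (\<mu>s i)" "q < r" ..
    then have "q \<in> {0<..<r}" "prokhorov_close X M \<mu> (\<mu>s i) t q" by simp_all
    then show "\<exists>q\<in>{0<..<r}. prokhorov_close X M \<mu> (\<mu>s i) t q" by blast
  qed
qed

section \<open>Convergence of the integrals\<close>

theorem proposition3p6:
  fixes X :: "'a set" and M :: "'a \<Rightarrow> 'a \<Rightarrow> real \<Rightarrow> real"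
    and \<mu>s :: "nat \<Rightarrow> 'a measure" and \<mu> :: "'a measure"
  assumes "fuzzy_metric_on X M"
    and "compact_space (fuzzy_topology X M)"
    and "\<And>i. \<mu>s i \<in> borel_prob_measures (fuzzy_topology X M)"
    and "\<mu> \<in> borel_prob_measures (fuzzy_topology X M)"
    and "limitin (fuzzy_topology (borel_prob_measures (fuzzy_topology X M)) (fuzzy_prokhorov X M))
           \<mu>s \<mu> sequentially"
  shows "weak_star_converges (fuzzy_topology X M) \<mu>s \<mu>"
  unfolding weak_star_converges_def
proof (intro allI impI)
  note N = assms(1) and C = assms(2)
  let ?T = "fuzzy_topology X M"
  have top: "topspace ?T = X" by (rule topspace_fuzzy_topology[OF N])
  fix \<phi> assume \<phi>: "continuous_map ?T euclideanreal \<phi>"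
  obtain B where B: "0 < B" "\<And>x. x \<in> X \<Longrightarrow> \<bar>\<phi> x\<bar> \<le> B"
    using compact_space_continuous_bounded[OF C \<phi>] top by metis
  \<comment> \<open>Layer sums need a nonnegative function; the shift changes each integral by
    exactly \<open>B\<close>.\<close>
  define f where "f x = \<phi> x + B" for x
  have f: "continuous_map ?T euclideanreal f"
    unfolding f_def using \<phi> by (intro continuous_map_add) auto
  have integral_f: "integral\<^sup>L \<nu> f = integral\<^sup>L \<nu> \<phi> + B" if "\<nu> \<in> borel_prob_measures ?T" for \<nu>
  proof -
    interpret prob_space \<nu> using borel_prob_measuresD[OF that] by simp
    have "integrable \<nu> \<phi>"
      using B borel_prob_measuresD(3)[OF that] top
      by (intro integrable_const_bound[where B = B] borel_measurable_continuous_map[OF that \<phi>])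
        auto
    then show ?thesis
      unfolding f_def by (subst Bochner_Integration.integral_add) (auto simp: prob_space)
  qed
  show "(\<lambda>i. integral\<^sup>L (\<mu>s i) \<phi>) \<longlonglongrightarrow> integral\<^sup>L \<mu> \<phi>"
  proof (rule LIMSEQ_I)
    fix \<epsilon> :: real assume "0 < \<epsilon>"
    define e where "e = \<epsilon> / 4"
    have e: "0 < e" using \<open>0 < \<epsilon>\<close> by (simp add: e_def)
    \<comment> \<open>The values of \<open>f\<close> lie between 0 and \<open>2 * B\<close>, so
      \<open>n\<close> layers of height \<open>e\<close> exhaust them.\<close>
    obtain n where n: "2 * B < real n * e" using reals_Archimedean3[OF e] by blast
    have n0: "0 < real n" using n B by (cases "n = 0") auto
    obtain d where d: "0 < d"
      "\<And>x y. x \<in> X \<Longrightarrow> y \<in> X \<Longrightarrow> 1 - d < M x y d \<Longrightarrow> \<bar>f x - f y\<bar> < e"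
      using fuzzy_uniformly_continuous[OF N C f e] by blast
    \<comment> \<open>For \<open>q < r\<close>, the bound \<open>d\<close> makes enlargement by
      \<open>q\<close> at time \<open>d\<close> change \<open>f\<close> by less than
      \<open>e\<close>, and \<open>1 / real n\<close> keeps the total error of the \<open>n\<close>
      levels below \<open>e\<close>. The \<open>1 / 2\<close> puts \<open>r\<close> inside the unit
      interval.\<close>
    define r where "r = min (min d (1 / real n)) (1 / 2)"
    have r: "r \<in> {0<..<1}" "r \<le> d" "r \<le> 1 / real n" using d n0 by (auto simp: r_def)
    \<comment> \<open>Only one direction of closeness enters here, so the bound can be applied to
      \<mu> and \<open>\<mu>s i\<close> in either order. As \<open>e\<close> is a quarter of
      \<epsilon>, the error \<open>3 * e\<close> is below \<epsilon>.\<close>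
    have bound: "integral\<^sup>L \<nu> f \<le> integral\<^sup>L \<nu>' f + 3 * e"
      if \<nu>: "\<nu> \<in> borel_prob_measures ?T" "\<nu>' \<in> borel_prob_measures ?T" and q: "q \<in> {0<..<r}"
        and close: "\<And>A. A \<in> sets (borel_of ?T) \<Longrightarrow>
          measure \<nu> A \<le> measure \<nu>' (fuzzy_enlargement X M A q d) + q"
      for \<nu> \<nu>' q
    proof -
      note D = borel_prob_measuresD[OF \<nu>(1)] and D' = borel_prob_measuresD[OF \<nu>(2)]
      interpret \<nu>': prob_space \<nu>' by (rule D'(1))
      have "measure \<nu> {x \<in> X. s < f x} \<le> measure \<nu>' {x \<in> X. s - e < f x} + q" for s
      proof -
        have "fuzzy_enlargement X M {x \<in> X. s < f x} q d \<subseteq> {x \<in> X. s - e < f x}"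
        proof
          fix y assume "y \<in> fuzzy_enlargement X M {x \<in> X. s < f x} q d"
          then obtain x where x: "x \<in> X" "s < f x" "y \<in> X" "1 - q < M x y d"
            by (auto simp: fuzzy_enlargement_def fuzzy_ball_def)
          moreover have "q < d" using q r by auto
          ultimately have "\<bar>f x - f y\<bar> < e" by (intro d(2)) auto
          with x show "y \<in> {x \<in> X. s - e < f x}" by auto
        qed
        moreover have "{x \<in> X. s - e < f x} \<in> sets \<nu>'"
          using openin_superlevel[OF f] top D'(2) by (metis sets_borel_of)
        ultimately have "measure \<nu>' (fuzzy_enlargement X M {x \<in> X. s < f x} q d)
            \<le> measure \<nu>' {x \<in> X. s - e < f x}"
          by (rule \<nu>'.finite_measure_mono)
        moreover have "{x \<in> X. s < f x} \<in> sets (borel_of ?T)"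
          using openin_superlevel[OF f] top by (metis sets_borel_of)
        ultimately show ?thesis using close by fastforce
      qed
      moreover have "0 \<le> f x \<and> f x \<le> real n * e" if "x \<in> X" for x
        using B(2)[OF that] n by (auto simp: f_def)
      ultimately have "integral\<^sup>L \<nu> f \<le> integral\<^sup>L \<nu>' f + 2 * e + real n * e * q"
        using D D' top e
        by (intro integral_le_of_superlevel_le borel_measurable_continuous_map[OF _ f] \<nu>) auto
      moreover have "real n * q \<le> 1"
      proof -
        have "q \<le> 1 / real n" using q r by simp
        then show ?thesis using n0 by (simp add: field_simps)
      qed
      then have "e * (real n * q) \<le> e * 1" using e by (intro mult_left_mono) auto
      ultimately show ?thesis by (simp add: mult_ac)
    qed
    have "eventually (\<lambda>i. \<exists>q\<in>{0<..<r}. prokhorov_close X M \<mu> (\<mu>s i) d q) sequentially"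
      by (rule limitin_fuzzy_prokhorov_close[OF assms r(1) d(1)])
    then have "eventually (\<lambda>i. norm (integral\<^sup>L (\<mu>s i) \<phi> - integral\<^sup>L \<mu> \<phi>) < \<epsilon>) sequentially"
    proof (rule eventually_mono)
      fix i assume "\<exists>q\<in>{0<..<r}. prokhorov_close X M \<mu> (\<mu>s i) d q"
      then obtain q where "q \<in> {0<..<r}" "prokhorov_close X M \<mu> (\<mu>s i) d q" by blast
      then have "integral\<^sup>L \<mu> f \<le> integral\<^sup>L (\<mu>s i) f + 3 * e"
        and "integral\<^sup>L (\<mu>s i) f \<le> integral\<^sup>L \<mu> f + 3 * e"
        using assms(3,4) by (auto simp: prokhorov_close_def intro!: bound[of _ _ q])
      then show "norm (integral\<^sup>L (\<mu>s i) \<phi> - integral\<^sup>L \<mu> \<phi>) < \<epsilon>"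
        using integral_f[OF assms(3)[of i]] integral_f[OF assms(4)] \<open>0 < \<epsilon>\<close>
        by (simp add: e_def abs_less_iff)
    qed
    then show "\<exists>m. \<forall>i\<ge>m. norm (integral\<^sup>L (\<mu>s i) \<phi> - integral\<^sup>L \<mu> \<phi>) < \<epsilon>"
      by (simp add: eventually_sequentially)
  qed
qed

end
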